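(* Let $G$ be a finite simple graph with maximum degree $\Delta_G$. Then the fractional strong chromatic index of $G$ satisfies $\chi'_{fs}(G) \le 1.75\,\Delta_G^2$.
   Context: An induced matching of $G$ is a set of pairwise disjoint edges of $G$ such that no edge of $G$ joins endpoints of two distinct edges of the set. Let $M(G)$ be the set of induced matchings of $G$. A fractional strong edge coloring of $G$ is a non-negative weighting $w: M(G)\to \mathbb{R}_{\ge 0}$ such that for each edge $e \in E(G)$, $\sum_{m \in M(G):\, e \in m} w(m) = 1$; its weight is $\sum_{m \in M(G)} w(m)$. The fractional strong chromatic index $\chi'_{fs}(G)$ is the minimum weight of a fractional strong edge coloring of $G$. *)

theory Defs
  imports "HOL-Analysis.Analysis"
begin

locale fin_simple_graph =
  fixes V :: "'a set" and E :: "'a set set"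
  assumes finite_vertices: "finite V"
    and edge_subset: "e \<in> E \<Longrightarrow> e \<subseteq> V"
    and edge_card: "e \<in> E \<Longrightarrow> card e = 2"

definition vertex_degree :: "'a set set \<Rightarrow> 'a \<Rightarrow> nat" where
  "vertex_degree E v = card {e \<in> E. v \<in> e}"

text \<open>The inserted \<open>0\<close> only matters for the graph without vertices, whose maximum degree is
  taken to be \<open>0\<close>; degrees are non-negative, so it does not change any other maximum.\<close>

definition max_degree :: "'a set \<Rightarrow> 'a set set \<Rightarrow> nat" where
  "max_degree V E = Max (insert 0 (vertex_degree E ` V))"

definition induced_matching :: "'a set set \<Rightarrow> 'a set set \<Rightarrow> bool" where
  "induced_matching E m \<longleftrightarrow> m \<subseteq> E \<and> pairwise disjnt m \<and>
     (\<forall>e\<in>m. \<forall>f\<in>m. e \<noteq> f \<longrightarrow> (\<forall>u\<in>e. \<forall>v\<in>f. {u, v} \<notin> E))"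

definition induced_matchings :: "'a set set \<Rightarrow> 'a set set set" where
  "induced_matchings E = {m. induced_matching E m}"

text \<open>A weighting is a total function, but only its values on induced matchings are
  constrained and only they contribute to the weight.\<close>

definition frac_strong_edge_coloring :: "'a set set \<Rightarrow> ('a set set \<Rightarrow> real) \<Rightarrow> bool" where
  "frac_strong_edge_coloring E w \<longleftrightarrow>
     (\<forall>m\<in>induced_matchings E. 0 \<le> w m) \<and>
     (\<forall>e\<in>E. (\<Sum>m | m \<in> induced_matchings E \<and> e \<in> m. w m) = 1)"

definition coloring_weight :: "'a set set \<Rightarrow> ('a set set \<Rightarrow> real) \<Rightarrow> real" where
  "coloring_weight E w = (\<Sum>m\<in>induced_matchings E. w m)"

text \<open>This is a genuine minimum: it is attained, as shown below.\<close>

definition frac_strong_chromatic_index :: "'a set set \<Rightarrow> real" where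
  "frac_strong_chromatic_index E =
     (LEAST c. \<exists>w. frac_strong_edge_coloring E w \<and> coloring_weight E w = c)"

lemma finite_induced_matchings:
  assumes "finite E"
  shows "finite (induced_matchings E)"
  by (rule finite_subset[of _ "Pow E"])
     (use assms in \<open>auto simp: induced_matchings_def induced_matching_def\<close>)

lemma singleton_induced_matching: "e \<in> E \<Longrightarrow> {e} \<in> induced_matchings E"
  by (simp add: induced_matchings_def induced_matching_def)

lemma ex_frac_strong_edge_coloring:
  assumes "finite E"
  shows "\<exists>w. frac_strong_edge_coloring E w"
proof
  let ?w = "\<lambda>m. if \<exists>e\<in>E. m = {e} then 1 else (0::real)"
  show "frac_strong_edge_coloring E ?w"
    unfolding frac_strong_edge_coloring_def
  proof (intro conjI ballI)
    fix e assume e: "e \<in> E"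
    let ?A = "{m \<in> induced_matchings E. e \<in> m}"
    have "sum ?w ?A = sum ?w {{e}}"
    proof (rule sum.mono_neutral_right)
      show "finite ?A" using finite_induced_matchings[OF assms] by simp
      show "{{e}} \<subseteq> ?A" using singleton_induced_matching[OF e] by auto
      show "\<forall>m\<in>?A - {{e}}. ?w m = 0" by auto
    qed
    then show "sum ?w ?A = 1" using e by simp
  qed simp
qed

lemma ex_optimal_frac_strong_edge_coloring:
  assumes fin: "finite E"
  obtains w where "frac_strong_edge_coloring E w"
    and "\<And>w'. frac_strong_edge_coloring E w' \<Longrightarrow> coloring_weight E w \<le> coloring_weight E w'"
proof -
  define M where "M = induced_matchings E"
  have finM: "finite M" using finite_induced_matchings[OF fin] by (simp add: M_def)
  let ?T = "product_topology (\<lambda>_. euclideanreal) M"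
  define B where "B = PiE M (\<lambda>_. {0..1::real})"
  define C where "C e = {w \<in> topspace ?T. sum w {m \<in> M. e \<in> m} \<in> {1::real}}" for e
  define K where "K = \<Inter> (insert (topspace ?T) (C ` E)) \<inter> B"
  have cont: "continuous_map ?T euclideanreal (\<lambda>w. sum w A)" if "A \<subseteq> M" for A
    using that finite_subset[OF that finM]
    by (intro continuous_map_sum) (auto intro: continuous_map_product_projection)
  have "compactin ?T B" unfolding B_def by (simp add: compactin_PiE)
  moreover have "closedin ?T (C e)" for e
    unfolding C_def by (rule closedin_continuous_map_preimage[OF cont]) auto
  then have "closedin ?T (\<Inter> (insert (topspace ?T) (C ` E)))"
    by (intro closedin_Inter) blast+
  ultimately have "compactin ?T K" unfolding K_def by (rule closed_Int_compactin[rotated])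
  then have cpt: "compact ((\<lambda>w. sum w M) ` K)"
    using image_compactin[OF _ cont[of M]] by force
  have K_iff: "w \<in> K \<longleftrightarrow> w \<in> B \<and> (\<forall>e\<in>E. sum w {m \<in> M. e \<in> m} = 1)" for w
    by (auto simp: K_def C_def B_def PiE_def)
  have col: "frac_strong_edge_coloring E w" if "w \<in> K" for w
    using that by (auto simp: K_iff frac_strong_edge_coloring_def M_def B_def PiE_def Pi_def)
  have trunc: "\<exists>v\<in>K. sum v M \<le> coloring_weight E w"
    if w: "frac_strong_edge_coloring E w" for w
  proof
    let ?v = "restrict (\<lambda>m. if m = {} then 0 else w m) M"
    have nn: "0 \<le> w m" if "m \<in> M" for m
      using w that by (simp add: frac_strong_edge_coloring_def M_def)
    have one: "sum w {m \<in> M. e \<in> m} = 1" if "e \<in> E" for e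
      using w that by (simp add: frac_strong_edge_coloring_def M_def)
    have le1: "w m \<le> 1" if m: "m \<in> M" and "m \<noteq> {}" for m
    proof -
      obtain e where e: "e \<in> m" using \<open>m \<noteq> {}\<close> by blast
      with m have "e \<in> E" by (auto simp: M_def induced_matchings_def induced_matching_def)
      moreover have "w m \<le> sum w {m \<in> M. e \<in> m}"
        by (rule member_le_sum) (use m e nn finM in auto)
      ultimately show ?thesis using one by simp
    qed
    have "sum ?v {m \<in> M. e \<in> m} = sum w {m \<in> M. e \<in> m}" for e
      by (rule sum.cong) auto
    with one nn le1 show "?v \<in> K" by (auto simp: K_iff B_def)
    show "sum ?v M \<le> coloring_weight E w"
      unfolding coloring_weight_def M_def[symmetric]
      by (rule sum_mono) (use nn in auto)
  qed
  obtain w0 where "frac_strong_edge_coloring E w0"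
    using ex_frac_strong_edge_coloring[OF fin] by blast
  then have "(\<lambda>w. sum w M) ` K \<noteq> {}" using trunc by blast
  from compact_attains_inf[OF cpt this] obtain w
    where w: "w \<in> K" "\<And>v. v \<in> K \<Longrightarrow> sum w M \<le> sum v M" by blast
  show thesis
  proof (rule that)
    show "frac_strong_edge_coloring E w" using col w(1) .
    fix w' assume "frac_strong_edge_coloring E w'"
    with trunc obtain v where "v \<in> K" "sum v M \<le> coloring_weight E w'" by blast
    with w(2)[of v] show "coloring_weight E w \<le> coloring_weight E w'"
      by (simp add: coloring_weight_def M_def)
  qed
qed

lemma frac_strong_chromatic_index_attained:
  assumes "finite E"
  obtains w where "frac_strong_edge_coloring E w"
    and "coloring_weight E w = frac_strong_chromatic_index E"
proof -
  obtain w where w: "frac_strong_edge_coloring E w"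
    "\<And>w'. frac_strong_edge_coloring E w' \<Longrightarrow> coloring_weight E w \<le> coloring_weight E w'"
    using ex_optimal_frac_strong_edge_coloring[OF assms] by blast
  then have "frac_strong_chromatic_index E = coloring_weight E w"
    unfolding frac_strong_chromatic_index_def by (intro Least_equality) auto
  with w show thesis using that by metis
qed

lemma frac_strong_chromatic_index_le:
  assumes "finite E" and w: "frac_strong_edge_coloring E w"
  shows "frac_strong_chromatic_index E \<le> coloring_weight E w"
proof -
  obtain v where v: "frac_strong_edge_coloring E v"
    "\<And>w'. frac_strong_edge_coloring E w' \<Longrightarrow> coloring_weight E v \<le> coloring_weight E w'"
    using ex_optimal_frac_strong_edge_coloring[OF assms(1)] by blast
  then have "frac_strong_chromatic_index E = coloring_weight E v"
    unfolding frac_strong_chromatic_index_def by (intro Least_equality) auto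
  with v(2)[OF w] show ?thesis by simp
qed

end

theory Submission
  imports Defs
begin

text \<open>Induced matchings are the stable sets of the conflict graph on the edges, the square of the
  line graph. With \<open>D\<close> the maximum degree of \<open>G\<close>, a closed neighbourhood in the conflict graph has
  at most \<open>2 D\<^sup>2\<close> elements and a clique has at most \<open>3/2 D\<^sup>2\<close>. The fractional form of Reed's
  conjecture (Molloy and Reed), stating that the fractional chromatic number is at most the
  average of clique number and maximum degree plus one, then gives \<open>7/4 D\<^sup>2\<close>.\<close>

section \<open>Maximum stable sets and fractional covers in a finite graph\<close>

definition stable_sets :: "('b \<Rightarrow> 'b \<Rightarrow> bool) \<Rightarrow> 'b set \<Rightarrow> 'b set set" where
  "stable_sets R X = {S. S \<subseteq> X \<and> (\<forall>x\<in>S. \<forall>y\<in>S. \<not> R x y)}"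

definition max_stable_sets :: "('b \<Rightarrow> 'b \<Rightarrow> bool) \<Rightarrow> 'b set \<Rightarrow> 'b set set" where
  "max_stable_sets R X = {S \<in> stable_sets R X. \<forall>S'\<in>stable_sets R X. card S' \<le> card S}"

lemma finite_stable_sets: "finite X \<Longrightarrow> finite (stable_sets R X)"
  by (rule finite_subset[of _ "Pow X"]) (auto simp: stable_sets_def)

lemma finite_max_stable_sets: "finite X \<Longrightarrow> finite (max_stable_sets R X)"
  by (simp add: max_stable_sets_def finite_stable_sets)

lemma max_stable_setsD:
  assumes "S \<in> max_stable_sets R X"
  shows "S \<subseteq> X" "\<And>x y. x \<in> S \<Longrightarrow> y \<in> S \<Longrightarrow> \<not> R x y"
    "\<And>S'. S' \<in> stable_sets R X \<Longrightarrow> card S' \<le> card S"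
  using assms by (auto simp: max_stable_sets_def stable_sets_def)

lemma max_stable_sets_nonempty:
  assumes "finite X"
  shows "max_stable_sets R X \<noteq> {}"
proof -
  let ?A = "stable_sets R X"
  have fin: "finite (card ` ?A)" using finite_stable_sets[OF assms] by simp
  have "{} \<in> ?A" by (simp add: stable_sets_def)
  then have "Max (card ` ?A) \<in> card ` ?A" using fin by (intro Max_in) auto
  then obtain S where S: "S \<in> ?A" "card S = Max (card ` ?A)" by auto
  then have "S \<in> max_stable_sets R X"
    using fin by (auto simp: max_stable_sets_def)
  then show ?thesis by blast
qed

lemma max_stable_set_member_nonempty:
  assumes "finite X" "X \<noteq> {}" "irreflp R" "S \<in> max_stable_sets R X"
  shows "S \<noteq> {}"
proof -
  obtain x where "x \<in> X" using assms by blast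
  then have "{x} \<in> stable_sets R X" using assms(3) by (auto simp: stable_sets_def irreflp_def)
  then show ?thesis using max_stable_setsD(3)[OF assms(4)] by fastforce
qed

text \<open>Double counting of the pairs \<open>x\<close> in \<open>S\<close>, weighted by
  \<open>g\<close>. It serves twice: for families of stable sets, and for edges regarded as sets of
  vertices.\<close>

lemma sum_card_member_swap:
  assumes "finite A" "finite B" "\<And>S. S \<in> A \<Longrightarrow> S \<subseteq> B"
  shows "(\<Sum>S\<in>A. \<Sum>x\<in>S. g x) = (\<Sum>x\<in>B. real (card {S \<in> A. x \<in> S}) * g x)"
proof -
  have "(\<Sum>S\<in>A. \<Sum>x\<in>S. g x) = (\<Sum>S\<in>A. \<Sum>x\<in>{x \<in> B. x \<in> S}. g x)"
    using assms by (intro sum.cong) auto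
  also have "\<dots> = (\<Sum>x\<in>B. \<Sum>S\<in>{S \<in> A. x \<in> S}. g x)"
    using assms by (intro sum.swap_restrict) auto
  finally show ?thesis by simp
qed

text \<open>A maximum stable set avoiding \<open>v\<close> contains at least one neighbour of \<open>v\<close>. If it contains
  exactly one, exchanging it for \<open>v\<close> gives a maximum stable set \<open>S\<close> through \<open>v\<close>; the neighbours
  that can arise in this way from a fixed \<open>S\<close> form, together with \<open>v\<close>, a clique.\<close>

lemma max_stable_sets_count:
  fixes c :: real
  assumes fin: "finite W" and sym: "symp R" and irr: "irreflp R"
    and c: "\<And>K. K \<subseteq> W \<Longrightarrow> pairwise R K \<Longrightarrow> card K \<le> c"
    and v: "v \<in> W"
  shows "2 * card (max_stable_sets R W) \<le>
    (c + 1) * card {S \<in> max_stable_sets R W. v \<in> S} +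
    (\<Sum>u | u \<in> W \<and> R v u. card {S \<in> max_stable_sets R W. u \<in> S})"
proof -
  define M where "M = max_stable_sets R W"
  define A where "A = {S \<in> M. v \<in> S}"
  define B where "B = {S \<in> M. v \<notin> S \<and> card {u \<in> S. R v u} = 1}"
  define U where "U S = {u \<in> W. R v u \<and> insert u (S - {v}) \<in> stable_sets R W}" for S
  have finM: "finite M" using fin by (simp add: M_def finite_max_stable_sets)
  have M: "S \<subseteq> W" "\<And>x y. x \<in> S \<Longrightarrow> y \<in> S \<Longrightarrow> \<not> R x y" "finite S"
    "\<And>S'. S' \<in> stable_sets R W \<Longrightarrow> card S' \<le> card S" if "S \<in> M" for S
    using that max_stable_setsD[of S R W] fin finite_subset unfolding M_def by blast+
  have symR: "R x y \<longleftrightarrow> R y x" for x y using sym by (auto dest: sympD)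
  have irrR: "\<not> R x x" for x using irr by (simp add: irreflp_def)
  have cardU: "real (card (U S)) \<le> c - 1" if "S \<in> A" for S
  proof -
    have S: "S \<in> M" "v \<in> S" using that by (auto simp: A_def)
    have "pairwise R (insert v (U S))"
    proof (rule pairwiseI)
      fix x y assume xy: "x \<in> insert v (U S)" "y \<in> insert v (U S)" "x \<noteq> y"
      show "R x y"
      proof (cases "x = v \<or> y = v")
        case True
        then show ?thesis using xy symR by (auto simp: U_def)
      next
        case False
        then have x: "x \<in> U S" and y: "y \<in> U S" using xy by auto
        show ?thesis
        \<comment> \<open>Two non-adjacent elements of \<open>U S\<close> could replace
          \<open>v\<close> together, which would give a stable set with one element more than
          \<open>S\<close>.\<close>
        proof (rule ccontr)
          assume "\<not> R x y"
          then have "insert x (insert y (S - {v})) \<in> stable_sets R W"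
            using x y symR irrR by (auto simp: U_def stable_sets_def)
          then have "card (insert x (insert y (S - {v}))) \<le> card S" using M(4) S by blast
          moreover have "x \<notin> S" "y \<notin> S" using x y M(2)[OF S(1)] S(2) by (auto simp: U_def)
          ultimately show False using S M(3)[OF S(1)] xy(3) card_Suc_Diff1[of S v] by simp
        qed
      qed
    qed
    then have "real (card (insert v (U S))) \<le> c" using v by (intro c) (auto simp: U_def)
    moreover have "v \<notin> U S" "finite (U S)" using irrR fin by (auto simp: U_def)
    ultimately show ?thesis by simp
  qed
  \<comment> \<open>Undoing the exchange recovers every member of \<open>B\<close> from some
    \<open>S\<close> in \<open>A\<close> and some \<open>u\<close> in \<open>U S\<close>, so
    \<open>B\<close> is no larger than the sum of the \<open>card (U S)\<close>.\<close>
  have "B \<subseteq> (\<Union>S\<in>A. (\<lambda>u. insert u (S - {v})) ` U S)"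
  proof
    fix S assume "S \<in> B"
    then have S: "S \<in> M" "v \<notin> S" and "card {u \<in> S. R v u} = 1" by (auto simp: B_def)
    then obtain u where u: "{u \<in> S. R v u} = {u}" by (auto simp: card_1_singleton_iff)
    define S' where "S' = insert v (S - {u})"
    have uS: "u \<in> S" "R v u" using u by auto
    have nv: "\<not> R v x" "\<not> R x v" if "x \<in> S - {u}" for x using u that symR by auto
    have st: "S' \<in> stable_sets R W"
      using M(1,2)[OF S(1)] v nv irrR by (auto simp: S'_def stable_sets_def)
    have "card S' = card S"
      using M(3)[OF S(1)] S(2) uS card_Suc_Diff1[of S u] by (simp add: S'_def)
    then have "S' \<in> M" using st M(4)[OF S(1)] by (auto simp: M_def max_stable_sets_def)
    then have "S' \<in> A" by (simp add: A_def S'_def)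
    moreover have eq: "S = insert u (S' - {v})" using S(2) uS by (auto simp: S'_def)
    moreover have "S \<in> stable_sets R W" using S(1) by (simp add: M_def max_stable_sets_def)
    then have "u \<in> U S'" using uS M(1)[OF S(1)] eq by (auto simp: U_def)
    ultimately show "S \<in> (\<Union>S\<in>A. (\<lambda>u. insert u (S - {v})) ` U S)" by blast
  qed
  moreover have finA: "finite A" using finM by (simp add: A_def)
  moreover have finU: "finite (U S)" for S using fin by (simp add: U_def)
  ultimately have "card B \<le> card (\<Union>S\<in>A. (\<lambda>u. insert u (S - {v})) ` U S)"
    by (intro card_mono) auto
  also have "\<dots> \<le> (\<Sum>S\<in>A. card ((\<lambda>u. insert u (S - {v})) ` U S))"
    by (rule card_UN_le[OF finA])
  also have "\<dots> \<le> (\<Sum>S\<in>A. card (U S))" by (intro sum_mono card_image_le finU)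
  finally have "real (card B) \<le> (\<Sum>S\<in>A. real (card (U S)))" by (simp flip: of_nat_sum)
  also have "\<dots> \<le> (\<Sum>S\<in>A. c - 1)" by (intro sum_mono cardU)
  finally have cardB: "real (card B) \<le> (c - 1) * card A" by (simp add: mult.commute)
  have ne: "card {u \<in> S. R v u} \<ge> 1" if "S \<in> M" "v \<notin> S" for S
  proof (rule ccontr)
    assume "\<not> ?thesis"
    then have "{u \<in> S. R v u} = {}" using M(3)[OF that(1)] by (simp add: Suc_le_eq card_gt_0_iff)
    then have "insert v S \<in> stable_sets R W"
      using M(1,2)[OF that(1)] v irrR symR by (auto simp: stable_sets_def)
    then have "card (insert v S) \<le> card S" using M(4) that by blast
    then show False using that M(3) by simp
  qed
  have "(\<Sum>u | u \<in> W \<and> R v u. real (card {S \<in> M. u \<in> S})) =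
      (\<Sum>u\<in>W. real (card {S \<in> M. u \<in> S}) * of_bool (R v u))"
    using fin by (intro sum.mono_neutral_cong_left) auto
  also have "\<dots> = (\<Sum>S\<in>M. \<Sum>u\<in>S. of_bool (R v u))"
    by (rule sum_card_member_swap[symmetric]) (use finM fin M(1) in auto)
  also have "\<dots> = (\<Sum>S\<in>M. real (card {u \<in> S. R v u}))"
    using M(3) by (intro sum.cong) (auto simp: Int_def)
  \<comment> \<open>Every \<open>S\<close> in \<open>M\<close> holds two neighbours of
    \<open>v\<close>, except that only one is assured for \<open>B\<close> and none is asked for in
    \<open>A\<close>. By \<open>cardB\<close> the total loss \<open>2 * card A + card B\<close> is
    at most \<open>(c + 1) * card A\<close>, whence the factor in the statement.\<close>
  also have "\<dots> \<ge> (\<Sum>S\<in>M. 2 - 2 * of_bool (S \<in> A) - of_bool (S \<in> B))"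
  proof (rule sum_mono)
    fix S assume "S \<in> M"
    then show "2 - 2 * of_bool (S \<in> A) - of_bool (S \<in> B) \<le> real (card {u \<in> S. R v u})"
      using ne[of S] by (auto simp: A_def B_def)
  qed
  also have "(\<Sum>S\<in>M. 2 - 2 * of_bool (S \<in> A) - of_bool (S \<in> B)) =
      2 * real (card M) - 2 * real (card A) - real (card B)"
  proof -
    have "M \<inter> A = A" "M \<inter> B = B" by (auto simp: A_def B_def)
    then show ?thesis using finM
      by (simp add: sum_subtractf flip: sum_distrib_left)
  qed
  finally show ?thesis using cardB by (simp add: A_def[symmetric] M_def[symmetric] algebra_simps)
qed

text \<open>While demand remains, serve it at the same rate through all maximum stable sets of the
  support, until one more demand is met. By the preceding lemma the left-hand side
  of the condition on \<open>T\<close> then decreases at least twice as fast as \<open>T\<close> is spent.\<close>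

lemma fractional_cover_of_demand:
  fixes c T :: real
  assumes fin: "finite X" and sym: "symp R" and irr: "irreflp R"
    and c: "\<And>K. K \<subseteq> X \<Longrightarrow> pairwise R K \<Longrightarrow> card K \<le> c"
    and r: "\<And>x. x \<in> X \<Longrightarrow> 0 \<le> r x" and T: "0 \<le> T"
    and demand: "\<And>v. v \<in> X \<Longrightarrow> 0 < r v \<Longrightarrow> (c + 1) * r v + (\<Sum>u | u \<in> X \<and> R v u. r u) \<le> 2 * T"
  shows "\<exists>w. (\<forall>S. 0 \<le> w S) \<and> (\<forall>v\<in>X. (\<Sum>S | S \<in> stable_sets R X \<and> v \<in> S. w S) = r v) \<and>
    (\<Sum>S\<in>stable_sets R X. w S) \<le> T"
  using r T demand
proof (induction "card {v \<in> X. 0 < r v}" arbitrary: r T rule: less_induct)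
  case less
  define W where "W = {v \<in> X. 0 < r v}"
  have WX: "W \<subseteq> X" and finW: "finite W" using fin by (auto simp: W_def)
  show ?case
  proof (cases "W = {}")
    case True
    then have "r v = 0" if "v \<in> X" for v using less.prems(1) that by (force simp: W_def)
    then show ?thesis using less.prems(2) by (intro exI[of _ "\<lambda>_. 0"]) auto
  next
    case False
    define M where "M = max_stable_sets R W"
    define n where "n v = real (card {S \<in> M. v \<in> S})" for v
    define P where "P = {v \<in> W. 0 < n v}"
    \<comment> \<open>The longest step that leaves no demand negative. A minimiser \<open>p\<close>
      has its demand met exactly, so the support shrinks and the induction proceeds.\<close>
    define t where "t = Min ((\<lambda>v. r v / n v) ` P)"
    define r' where "r' v = r v - t * n v" for v
    define T' where "T' = T - t * card M"
    have finM: "finite M" using finW by (simp add: M_def finite_max_stable_sets)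
    have MW: "S \<subseteq> W" if "S \<in> M" for S using that max_stable_setsD(1) unfolding M_def by blast
    have MX: "M \<subseteq> stable_sets R X"
      using WX by (auto simp: M_def max_stable_sets_def stable_sets_def)
    have n0: "n v = 0" if "v \<notin> W" for v
    proof -
      have "{S \<in> M. v \<in> S} = {}" using MW that by blast
      then show ?thesis unfolding n_def by (simp only: card.empty of_nat_0)
    qed
    have n_nonneg: "0 \<le> n v" for v by (simp add: n_def)
    have "P \<noteq> {}"
    proof -
      obtain S where S: "S \<in> M" using max_stable_sets_nonempty[OF finW] by (auto simp: M_def)
      then obtain v where "v \<in> S"
        using max_stable_set_member_nonempty[OF finW False irr] by (auto simp: M_def)
      then have "v \<in> P" using S MW finM by (auto simp: P_def n_def card_gt_0_iff)
      then show ?thesis by blast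
    qed
    moreover have finP: "finite P" using finW by (simp add: P_def)
    ultimately have "t \<in> (\<lambda>v. r v / n v) ` P" unfolding t_def by (intro Min_in) auto
    then obtain p where p: "p \<in> P" "t = r p / n p" by blast
    have tpos: "0 < t" using p by (auto simp: P_def W_def)
    have tle: "t * n v \<le> r v" if "v \<in> X" for v
    proof (cases "v \<in> P")
      case True
      then have "t \<le> r v / n v" unfolding t_def using finP by (intro Min_le) auto
      then show ?thesis using True by (simp add: P_def field_simps)
    next
      case False
      then have "v \<notin> W \<or> n v \<le> 0" by (auto simp: P_def)
      then have "n v = 0" using n0[of v] n_nonneg[of v] by auto
      then show ?thesis using less.prems(1)[OF that] by simp
    qed
    have r'0: "0 \<le> r' v" if "v \<in> X" for v using tle[OF that] by (simp add: r'_def)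
    have r'W: "v \<in> W" if "v \<in> X" "0 < r' v" for v
    proof -
      have "0 \<le> t * n v" using n_nonneg[of v] tpos by simp
      with that(2) have "0 < r v" unfolding r'_def by linarith
      with that(1) show ?thesis by (simp add: W_def)
    qed
    \<comment> \<open>The count is applied inside \<open>W\<close>; its sum extends to
      \<open>X\<close> because \<open>n\<close> vanishes outside \<open>W\<close>. Scaled by
      \<open>t\<close>, it says that the left-hand side drops by at least
      \<open>2 * t * card M\<close>, which is \<open>2 * (T - T')\<close>.\<close>
    have r'T: "(c + 1) * r' v + (\<Sum>u | u \<in> X \<and> R v u. r' u) \<le> 2 * T'" if v: "v \<in> W" for v
    proof -
      have "2 * card M \<le> (c + 1) * n v + (\<Sum>u | u \<in> W \<and> R v u. n u)"
        unfolding n_def M_def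
        using max_stable_sets_count[OF finW sym irr _ v, of c] c WX by auto
      also have "(\<Sum>u | u \<in> W \<and> R v u. n u) = (\<Sum>u | u \<in> X \<and> R v u. n u)"
        using WX fin n0 by (intro sum.mono_neutral_left) auto
      finally have "t * (2 * card M) \<le> t * ((c + 1) * n v + (\<Sum>u | u \<in> X \<and> R v u. n u))"
        using tpos by simp
      moreover have "(c + 1) * r v + (\<Sum>u | u \<in> X \<and> R v u. r u) \<le> 2 * T"
        using less.prems(3) v by (auto simp: W_def)
      ultimately show ?thesis
        by (simp add: r'_def T'_def sum_subtractf algebra_simps flip: sum_distrib_left)
    qed
    have "0 \<le> c" using c[of "{}"] by simp
    have "0 \<le> T'"
    proof -
      obtain v where v: "v \<in> W" using False by blast
      have "0 \<le> (c + 1) * r' v + (\<Sum>u | u \<in> X \<and> R v u. r' u)"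
        using \<open>0 \<le> c\<close> r'0 v WX by (intro add_nonneg_nonneg mult_nonneg_nonneg sum_nonneg) auto
      with r'T[OF v] show ?thesis by simp
    qed
    have "r' p = 0" using p by (simp add: r'_def P_def)
    then have "{v \<in> X. 0 < r' v} \<subset> {v \<in> X. 0 < r v}"
    proof (intro psubsetI)
      show "{v \<in> X. 0 < r' v} \<subseteq> {v \<in> X. 0 < r v}" using r'W by (auto simp: W_def)
      have "p \<in> {v \<in> X. 0 < r v}" using p by (simp add: P_def W_def)
      then show "{v \<in> X. 0 < r' v} \<noteq> {v \<in> X. 0 < r v}" using \<open>r' p = 0\<close> by force
    qed
    then have "card {v \<in> X. 0 < r' v} < card {v \<in> X. 0 < r v}"
      using fin by (intro psubset_card_mono) auto
    from less.hyps[OF this, of T'] r'0 \<open>0 \<le> T'\<close> r'T r'W obtain w where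
      w: "\<And>S. 0 \<le> w S" "\<And>v. v \<in> X \<Longrightarrow> (\<Sum>S | S \<in> stable_sets R X \<and> v \<in> S. w S) = r' v"
      "(\<Sum>S\<in>stable_sets R X. w S) \<le> T'" by blast
    define w' where "w' S = w S + t * of_bool (S \<in> M)" for S
    have finX: "finite (stable_sets R X)" using finite_stable_sets[OF fin] .
    have sum_w': "sum w' Q = sum w Q + t * card (Q \<inter> M)" if "Q \<subseteq> stable_sets R X" for Q
      using finite_subset[OF that finX]
      by (simp add: w'_def sum.distrib Int_def flip: sum_distrib_left)
    have "sum w' {S. S \<in> stable_sets R X \<and> v \<in> S} = r v" if "v \<in> X" for v
    proof -
      have "{S. S \<in> stable_sets R X \<and> v \<in> S} \<inter> M = {S \<in> M. v \<in> S}" using MX by auto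
      then show ?thesis using w(2)[OF that] by (subst sum_w') (auto simp: r'_def n_def)
    qed
    moreover have "sum w' (stable_sets R X) \<le> T"
      using w(3) MX by (simp add: sum_w' T'_def Int_absorb1)
    moreover have "0 \<le> w' S" for S using w(1) tpos by (simp add: w'_def)
    ultimately show ?thesis by blast
  qed
qed

section \<open>The conflict graph on the edges\<close>

definition conflict :: "'a set set \<Rightarrow> 'a set \<Rightarrow> 'a set \<Rightarrow> bool" where
  "conflict E e f \<longleftrightarrow> e \<noteq> f \<and> (\<exists>u\<in>e. \<exists>v\<in>f. u = v \<or> {u, v} \<in> E)"

lemma symp_conflict: "symp (conflict E)"
proof (rule sympI)
  fix e f assume "conflict E e f"
  then obtain u v where "e \<noteq> f" "u \<in> e" "v \<in> f" "v = u \<or> {v, u} \<in> E"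
    unfolding conflict_def by (metis insert_commute)
  then show "conflict E f e" unfolding conflict_def by blast
qed

lemma irreflp_conflict: "irreflp (conflict E)"
  by (simp add: irreflp_def conflict_def)

lemma stable_sets_conflict: "stable_sets (conflict E) E = induced_matchings E"
proof -
  have "(\<forall>e\<in>m. \<forall>f\<in>m. \<not> conflict E e f) \<longleftrightarrow>
      pairwise disjnt m \<and> (\<forall>e\<in>m. \<forall>f\<in>m. e \<noteq> f \<longrightarrow> (\<forall>u\<in>e. \<forall>v\<in>f. {u, v} \<notin> E))" for m
  proof -
    have "\<not> conflict E e f \<longleftrightarrow>
        (e \<noteq> f \<longrightarrow> disjnt e f) \<and> (e \<noteq> f \<longrightarrow> (\<forall>u\<in>e. \<forall>v\<in>f. {u, v} \<notin> E))" for e f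
      unfolding conflict_def disjnt_iff by (cases "e = f") blast+
    then show ?thesis by (simp only: pairwise_def ball_conj_distrib)
  qed
  then show ?thesis
    by (simp add: stable_sets_def induced_matchings_def induced_matching_def)
qed

section \<open>Neighbourhoods, degree counts and strong cliques\<close>

definition nbhd :: "'a set set \<Rightarrow> 'a \<Rightarrow> 'a set" where
  "nbhd E v = {u. {v, u} \<in> E}"

context fin_simple_graph
begin

lemma finite_edges: "finite E"
  by (rule finite_subset[of _ "Pow V"]) (use finite_vertices edge_subset in auto)

lemma edge_cases:
  assumes "e \<in> E"
  obtains u v where "e = {u, v}" "u \<noteq> v" "u \<in> V" "v \<in> V"
proof -
  obtain u v where "e = {u, v}" "u \<noteq> v" using edge_card[OF assms] by (meson card_2_iff)
  then show thesis using that edge_subset[OF assms] by blast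
qed

lemma nbhd_subset: "nbhd E v \<subseteq> V"
  using edge_subset by (auto simp: nbhd_def)

lemma finite_nbhd: "finite (nbhd E v)"
  using nbhd_subset finite_vertices finite_subset by blast

lemma card_nbhd:
  assumes "F \<subseteq> E"
  shows "card (nbhd F v) = vertex_degree F v"
proof -
  have "{f \<in> F. v \<in> f} = (\<lambda>u. {v, u}) ` nbhd F v"
  proof (rule set_eqI, rule iffI)
    fix f assume "f \<in> {f \<in> F. v \<in> f}"
    then have f: "f \<in> F" "v \<in> f" by auto
    then obtain x y where "f = {x, y}" using assms edge_cases by (metis subsetD)
    then obtain u where "f = {v, u}" using f by blast
    then show "f \<in> (\<lambda>u. {v, u}) ` nbhd F v" using f by (auto simp: nbhd_def)
  qed (auto simp: nbhd_def)
  moreover have "inj_on (\<lambda>u. {v, u}) (nbhd F v)"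
    by (auto simp: inj_on_def doubleton_eq_iff)
  ultimately show ?thesis by (simp add: vertex_degree_def card_image)
qed

lemma vertex_degree_le_max_degree: "vertex_degree E v \<le> max_degree V E"
proof (cases "v \<in> V")
  case True
  then show ?thesis using finite_vertices by (simp add: max_degree_def)
next
  case False
  then have "{e \<in> E. v \<in> e} = {}" using edge_subset by auto
  then show ?thesis unfolding vertex_degree_def by (simp only: card.empty)
qed

lemma vertex_degree_mono: "F \<subseteq> E \<Longrightarrow> vertex_degree F v \<le> vertex_degree E v"
  unfolding vertex_degree_def using finite_edges by (intro card_mono) auto

lemma card_nbhd_le: "card (nbhd E v) \<le> max_degree V E"
  using vertex_degree_le_max_degree by (simp add: card_nbhd)

lemma card_edges_meeting_le:
  assumes "F \<subseteq> E" "finite A" "\<And>x. x \<in> A \<Longrightarrow> vertex_degree F x \<le> k"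
  shows "card {f \<in> F. f \<inter> A \<noteq> {}} \<le> card A * k"
proof -
  have "{f \<in> F. f \<inter> A \<noteq> {}} = (\<Union>x\<in>A. {f \<in> F. x \<in> f})" by auto
  then have "card {f \<in> F. f \<inter> A \<noteq> {}} \<le> (\<Sum>x\<in>A. vertex_degree F x)"
    unfolding vertex_degree_def using card_UN_le[OF assms(2)] by simp
  also have "\<dots> \<le> card A * k" using sum_bounded_above[OF assms(3)] by simp
  finally show ?thesis .
qed

text \<open>If the edges share a vertex, the other end of \<open>f\<close> is a neighbour of it;
  otherwise an edge joining them ends in \<open>f\<close> at such a neighbour. Conflicts can thus be
  counted as edges meeting two neighbourhoods.\<close>

lemma conflict_meets_nbhd:
  assumes "f \<in> E" "conflict E {u, v} f"
  shows "f \<inter> (nbhd E u \<union> nbhd E v) \<noteq> {}"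
proof -
  obtain p q where pq: "p \<in> {u, v}" "q \<in> f" "p = q \<or> {p, q} \<in> E"
    using assms(2) unfolding conflict_def by blast
  obtain z where "z \<in> f" "{p, z} \<in> E"
  proof (cases "p = q")
    case True
    obtain x y where "f = {x, y}" using edge_cases assms(1) by metis
    with True pq(2) obtain z where "f = {p, z}" by blast
    then show thesis using that[of z] assms(1) by simp
  qed (use that pq in blast)
  then show ?thesis using pq(1) by (auto simp: nbhd_def)
qed

text \<open>All edges in conflict with \<open>e\<close> meet the at most 2 D neighbours of its ends,
  each on at most D edges. The edge \<open>e\<close> meets them too, its ends being adjacent; this
  pays for the \<open>+ 1\<close>, which later cancels that of \<open>c + 1\<close>.\<close>

lemma card_conflicting_le:
  assumes "e \<in> E"
  shows "card {f \<in> E. conflict E e f} + 1 \<le> 2 * (max_degree V E)\<^sup>2"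
proof -
  obtain u v where e: "e = {u, v}" "u \<noteq> v" using edge_cases[OF assms] by metis
  let ?A = "nbhd E u \<union> nbhd E v"
  have "card {f \<in> E. conflict E e f} + 1 = card (insert e {f \<in> E. conflict E e f})"
    using finite_edges by (simp add: conflict_def)
  also have "\<dots> \<le> card {f \<in> E. f \<inter> ?A \<noteq> {}}"
  proof (rule card_mono)
    have "e \<inter> ?A \<noteq> {}" using assms e by (auto simp: nbhd_def insert_commute)
    then show "insert e {f \<in> E. conflict E e f} \<subseteq> {f \<in> E. f \<inter> ?A \<noteq> {}}"
      using assms e conflict_meets_nbhd[of _ u v] by auto
  qed (use finite_edges in simp)
  also have "\<dots> \<le> card ?A * max_degree V E"
    by (rule card_edges_meeting_le) (auto simp: finite_nbhd vertex_degree_le_max_degree)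
  also have "\<dots> \<le> (max_degree V E + max_degree V E) * max_degree V E"
    using card_Un_le[of "nbhd E u" "nbhd E v"] card_nbhd_le[of u] card_nbhd_le[of v]
    by (intro mult_le_mono1) linarith
  finally show ?thesis by (simp add: power2_eq_square mult_2 add_mult_distrib)
qed

text \<open>Let \<open>v\<close> be a vertex of maximum degree \<open>k\<close> in the graph \<open>C\<close>, and let \<open>a x\<close> be the number of
  neighbours of \<open>x\<close> in \<open>U = nbhd C v\<close>. An edge \<open>xy\<close> of \<open>C\<close> avoiding \<open>nbhd E v\<close> satisfies
  \<open>a x + a y \<ge> k\<close>, while \<open>x\<close> lies on at most \<open>D - a x\<close> such edges.
  Give \<open>xy\<close> the weight \<open>a x / (D - a x) + a y / (D - a y)\<close>: it is at least \<open>2 k / (2 D - k)\<close> by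
  convexity, and the total weight is at most the sum of all \<open>a x\<close>, which is at most \<open>k D\<close>.\<close>

lemma card_strong_clique_le:
  assumes CE: "C \<subseteq> E" and clique: "pairwise (conflict E) C"
  shows "real (card C) \<le> 3 / 2 * (real (max_degree V E))\<^sup>2"
proof (cases "C = {}")
  case False
  define D where "D = max_degree V E"
  have finC: "finite C" using CE finite_edges finite_subset by blast
  define k where "k = Max (vertex_degree C ` V)"
  obtain e0 where "e0 \<in> C" using False by blast
  then obtain u0 where u0: "u0 \<in> V" "u0 \<in> e0" using CE edge_cases[of e0] by blast
  have deg_le_k: "vertex_degree C x \<le> k" if "x \<in> V" for x
    using that finite_vertices by (simp add: k_def)
  have "k \<in> vertex_degree C ` V" unfolding k_def using finite_vertices u0 by (intro Max_in) auto
  then obtain v where v: "v \<in> V" "vertex_degree C v = k" by blast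
  have "vertex_degree C u0 > 0"
    using u0 \<open>e0 \<in> C\<close> finC by (auto simp: vertex_degree_def card_gt_0_iff)
  then have k0: "0 < k" using deg_le_k[OF u0(1)] by simp
  have kD: "k \<le> D"
    using v vertex_degree_mono[OF CE, of v] vertex_degree_le_max_degree[of v] by (simp add: D_def)
  define U where "U = nbhd C v"
  define F where "F = {f \<in> C. f \<inter> nbhd E v = {}}"
  define a where "a x = card (nbhd E x \<inter> U)" for x
  have UN: "U \<subseteq> nbhd E v" using CE by (auto simp: U_def nbhd_def)
  have finU: "finite U" using UN finite_nbhd finite_subset by blast
  have cardU: "card U = k" using card_nbhd[OF CE] v by (simp add: U_def)
  have FE: "F \<subseteq> E" using CE by (auto simp: F_def)
  have finF: "finite F" using finC by (simp add: F_def)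
  \<comment> \<open>The neighbours of \<open>v\<close> account for at most \<open>D * k\<close>
    edges of \<open>C\<close>; what remains is to bound \<open>F\<close>.\<close>
  have "card C \<le> card {f \<in> C. f \<inter> nbhd E v \<noteq> {}} + card F"
    using card_Un_le[of "{f \<in> C. f \<inter> nbhd E v \<noteq> {}}" F]
    by (rule order_trans[rotated]) (auto simp: F_def intro!: card_mono finC)
  also have "card {f \<in> C. f \<inter> nbhd E v \<noteq> {}} \<le> card (nbhd E v) * k"
    using CE finite_nbhd deg_le_k subsetD[OF nbhd_subset] by (intro card_edges_meeting_le) auto
  also have "\<dots> \<le> D * k" using card_nbhd_le by (simp add: D_def)
  finally have cardC: "card C \<le> D * k + card F" by simp
  \<comment> \<open>Edges of \<open>F\<close> avoid \<open>nbhd E v\<close>, which contains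
    \<open>U\<close>, so the neighbours of \<open>x\<close> along \<open>F\<close> and those in
    \<open>U\<close> are disjoint parts of \<open>nbhd E x\<close>.\<close>
  have degF: "vertex_degree F x + a x \<le> D" for x
  proof -
    have "nbhd F x \<inter> (nbhd E x \<inter> U) = {}" using UN by (auto simp: nbhd_def F_def)
    moreover have "finite (nbhd F x)"
      using FE finite_nbhd[of x] by (rule_tac finite_subset[of _ "nbhd E x"]) (auto simp: nbhd_def)
    ultimately have "vertex_degree F x + a x = card (nbhd F x \<union> (nbhd E x \<inter> U))"
      using finite_nbhd by (simp add: a_def card_Un_disjoint flip: card_nbhd[OF FE])
    also have "\<dots> \<le> card (nbhd E x)"
      using FE finite_nbhd by (intro card_mono) (auto simp: nbhd_def)
    finally show ?thesis using card_nbhd_le[of x] by (simp add: D_def)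
  qed
  have a_sum: "(\<Sum>x\<in>V. a x) \<le> k * D"
  proof -
    have "(\<Sum>x\<in>V. a x) = (\<Sum>x\<in>V. \<Sum>u | u \<in> U \<and> {x, u} \<in> E. 1)"
      by (auto simp: a_def nbhd_def Int_def intro!: sum.cong arg_cong[of _ _ card])
    also have "\<dots> = (\<Sum>u\<in>U. \<Sum>x | x \<in> V \<and> {x, u} \<in> E. 1)"
      using finite_vertices finU by (rule sum.swap_restrict)
    also have "\<dots> \<le> (\<Sum>u\<in>U. card (nbhd E u))"
      by (auto simp: nbhd_def insert_commute intro!: sum_mono card_mono finite_nbhd[unfolded nbhd_def])
    also have "\<dots> \<le> k * D"
      using sum_bounded_above[of U "\<lambda>u. card (nbhd E u)" D] card_nbhd_le cardU by (simp add: D_def)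
    finally show ?thesis .
  qed
  \<comment> \<open>If \<open>a x = D\<close>, division by zero makes \<open>g x\<close> zero; by
    \<open>degF\<close> no edge of \<open>F\<close> then contains \<open>x\<close>, and the bounds
    below still hold.\<close>
  define g where "g x = real (a x) / (real D - real (a x))" for x
  have weight_ge: "2 * real k / (2 * real D - real k) \<le> (\<Sum>x\<in>f. g x)" if f: "f \<in> F" for f
  proof -
    obtain x y where xy: "f = {x, y}" "x \<noteq> y" using edge_cases f FE by (metis subsetD)
    have "vertex_degree F z > 0" if "z \<in> f" for z
      using that f finF by (auto simp: vertex_degree_def card_gt_0_iff)
    then have pos: "a x < D" "a y < D" using degF[of x] degF[of y] xy by fastforce+
    \<comment> \<open>The clique property makes \<open>f\<close> conflict with each edge
      \<open>{v, u}\<close> of \<open>C\<close>. As \<open>f\<close> misses \<open>nbhd E v\<close>,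
      it must contain a neighbour of \<open>u\<close>.\<close>
    have "U \<subseteq> (nbhd E x \<inter> U) \<union> (nbhd E y \<inter> U)"
    proof
      fix u assume u: "u \<in> U"
      then have vu: "{v, u} \<in> C" "{v, u} \<in> E" using CE by (auto simp: U_def nbhd_def)
      have fN: "x \<notin> nbhd E v" "y \<notin> nbhd E v" using f xy by (auto simp: F_def)
      have "u \<in> nbhd E v" using u UN by auto
      then have ne: "{v, u} \<noteq> f" using fN xy by (auto simp: doubleton_eq_iff)
      then have "conflict E {v, u} f" using clique vu f by (auto simp: pairwise_def F_def)
      moreover have "f \<in> E" using f FE by auto
      ultimately have "f \<inter> (nbhd E v \<union> nbhd E u) \<noteq> {}" using vu conflict_meets_nbhd by blast
      then show "u \<in> (nbhd E x \<inter> U) \<union> (nbhd E y \<inter> U)"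
        using fN xy u by (auto simp: nbhd_def insert_commute)
    qed
    then have "card U \<le> card ((nbhd E x \<inter> U) \<union> (nbhd E y \<inter> U))"
      using finU by (intro card_mono) auto
    also have "\<dots> \<le> a x + a y" unfolding a_def by (rule card_Un_le)
    finally have axy: "k \<le> a x + a y" using cardU by simp
    \<comment> \<open>In these terms \<open>g x = D / p - 1\<close> and
      \<open>g y = D / q - 1\<close>, so convexity takes the form
      \<open>1 / p + 1 / q \<ge> 4 / (p + q)\<close>.\<close>
    define p q where "p = real D - real (a x)" and "q = real D - real (a y)"
    have pq: "0 < p" "0 < q" "p + q \<le> 2 * real D - real k"
      using pos axy by (auto simp: p_def q_def)
    have "4 / (2 * real D - real k) \<le> 4 / (p + q)" using pq by (intro divide_left_mono) auto
    also have "\<dots> \<le> 1 / p + 1 / q"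
    proof -
      have "4 * (p * q) \<le> (p + q) * (p + q)"
        using zero_le_power2[of "p - q"] by (simp add: power2_eq_square algebra_simps)
      then show ?thesis using pq by (simp add: field_simps)
    qed
    finally have "real D * (4 / (2 * real D - real k)) \<le> real D * (1 / p + 1 / q)"
      by (intro mult_left_mono) auto
    moreover have "g x = (real D - p) / p" "g y = (real D - q) / q"
      by (simp_all add: g_def p_def q_def)
    then have "g x + g y = real D * (1 / p + 1 / q) - 2"
      using pq by (simp add: diff_divide_distrib distrib_left)
    moreover have "2 * real k / (2 * real D - real k) = real D * (4 / (2 * real D - real k)) - 2"
      using pq by (simp add: field_simps)
    ultimately show ?thesis using xy by simp
  qed
  have "card F * (2 * real k / (2 * real D - real k)) \<le> (\<Sum>f\<in>F. \<Sum>x\<in>f. g x)"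
    by (intro sum_bounded_below weight_ge)
  also have "\<dots> = (\<Sum>x\<in>V. real (vertex_degree F x) * g x)"
    unfolding vertex_degree_def using finF finite_vertices FE edge_subset
    by (intro sum_card_member_swap) auto
  also have "\<dots> \<le> (\<Sum>x\<in>V. real (a x))"
  proof (rule sum_mono)
    fix x
    have "real (vertex_degree F x) \<le> real D - real (a x)" using degF[of x] by linarith
    then have "real (vertex_degree F x) * g x \<le> (real D - real (a x)) * g x"
      using degF[of x] by (intro mult_right_mono) (auto simp: g_def)
    also have "\<dots> \<le> real (a x)" by (simp add: g_def)
    finally show "real (vertex_degree F x) * g x \<le> real (a x)" .
  qed
  also have "\<dots> \<le> real k * real D" using a_sum by (simp flip: of_nat_sum of_nat_mult)
  finally have "card F * (2 * real k / (2 * real D - real k)) \<le> real k * real D" .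
  \<comment> \<open>Cancelling \<open>k\<close> bounds \<open>F\<close> by D^2 - D k / 2. With the D
    k edges set aside this gives D^2 + D k / 2, at most 3/2 D^2 because
    \<open>k \<le> D\<close>.\<close>
  then have "real k * (2 * card F) \<le> real k * (real D * (2 * real D - real k))"
    using k0 kD by (simp add: field_simps)
  then have "2 * real (card F) \<le> real D * (2 * real D - real k)" using k0 by simp
  moreover have "real (card C) \<le> real D * real k + real (card F)"
    using cardC by (simp flip: of_nat_mult of_nat_add)
  moreover have "real D * real k \<le> real D * real D" using kD by (simp add: mult_left_mono)
  ultimately show ?thesis by (simp add: D_def[symmetric] power2_eq_square algebra_simps)
qed simp

end

section \<open>The bound on the fractional strong chromatic index\<close>

theorem theorem3:
  fixes V :: "'a set" and E :: "'a set set"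
  assumes "fin_simple_graph V E"
  shows "frac_strong_chromatic_index E \<le> 1.75 * (real (max_degree V E))\<^sup>2"
proof -
  interpret fin_simple_graph V E by fact
  let ?D = "real (max_degree V E)"
  have "\<exists>w. (\<forall>S. 0 \<le> w S) \<and>
      (\<forall>e\<in>E. (\<Sum>S | S \<in> stable_sets (conflict E) E \<and> e \<in> S. w S) = 1) \<and>
      (\<Sum>S\<in>stable_sets (conflict E) E. w S) \<le> 1.75 * ?D\<^sup>2"
  proof (rule fractional_cover_of_demand[where c = "3 / 2 * ?D\<^sup>2"])
    \<comment> \<open>Every edge has demand 1, so the left-hand side is at most (3/2 D^2 + 1) + (2
      D^2 - 1) = 7/2 D^2, twice the claimed weight.\<close>
    fix e assume "e \<in> E"
    from card_conflicting_le[OF this]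
    have "real (card {f \<in> E. conflict E e f} + 1) \<le> real (2 * (max_degree V E)\<^sup>2)"
      by (simp only: of_nat_le_iff)
    then show "(3 / 2 * ?D\<^sup>2 + 1) * 1 + (\<Sum>f | f \<in> E \<and> conflict E e f. 1) \<le> 2 * (1.75 * ?D\<^sup>2)"
      by simp
  qed (use finite_edges symp_conflict irreflp_conflict card_strong_clique_le in auto)
  then obtain w where w: "\<And>S. 0 \<le> w S"
    "\<And>e. e \<in> E \<Longrightarrow> (\<Sum>S | S \<in> induced_matchings E \<and> e \<in> S. w S) = 1"
    "(\<Sum>S\<in>induced_matchings E. w S) \<le> 1.75 * ?D\<^sup>2"
    by (auto simp: stable_sets_conflict)
  then have "frac_strong_edge_coloring E w" by (simp add: frac_strong_edge_coloring_def)
  from frac_strong_chromatic_index_le[OF finite_edges this] w(3) show ?thesis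
    by (simp add: coloring_weight_def)
qed

end
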